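(* Let $H: L^2(0,1)\to\ell^2$ be the Hausdorff moment operator, $[Hx]_j=\int_0^1 x(t)\,t^{j-1}\,dt$ for $j=1,2,\ldots$, and let $C^*: L^2(0,1)\to L^2(0,1)$ be the adjoint Cesàro operator, $[C^*x](t)=\int_t^1 \frac{x(s)}{s}\,ds$ for $0\le t\le 1$. Then the operator $T:=H\,C^*: L^2(0,1)\to\ell^2$ is compact and even a Hilbert–Schmidt operator.
   Context: $L^2(0,1)$ and $\ell^2$ (sequences indexed by $j=1,2,\ldots$) are real Hilbert spaces. Both $H$ and $C^*$ are known to be bounded linear operators that are non-compact and have non-closed range. $C^*$ is the adjoint of the Cesàro operator $C:L^2(0,1)\to L^2(0,1)$, $[Cx](s)=\frac1s\int_0^s x(t)\,dt$. *)

theory Defs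
  imports "HOL-Analysis.Analysis"
begin

section \<open>Square-integrable functions\<close>

definition square_integrable :: "'a measure \<Rightarrow> ('a \<Rightarrow> real) \<Rightarrow> bool" where
  "square_integrable M f \<longleftrightarrow> f \<in> borel_measurable M \<and> integrable M (\<lambda>x. (f x)\<^sup>2)"

lemma square_integrable_measurable:
  "square_integrable M f \<Longrightarrow> f \<in> borel_measurable M"
  by (simp add: square_integrable_def)

lemma square_integrable_mult:
  assumes "square_integrable M f" "square_integrable M g"
  shows "integrable M (\<lambda>x. f x * g x)"
proof (rule Bochner_Integration.integrable_bound)
  show "integrable M (\<lambda>x. (f x)\<^sup>2 + (g x)\<^sup>2)"
    using assms by (simp add: square_integrable_def)
  show "(\<lambda>x. f x * g x) \<in> borel_measurable M"
    using assms by (intro borel_measurable_times) (auto simp: square_integrable_def)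
  have "\<bar>a * b\<bar> \<le> a\<^sup>2 + b\<^sup>2" for a b :: real
    using sum_squares_bound[of "\<bar>a\<bar>" "\<bar>b\<bar>"] abs_ge_zero[of "a * b"]
    unfolding abs_mult power2_abs by linarith
  then show "AE x in M. norm (f x * g x) \<le> norm ((f x)\<^sup>2 + (g x)\<^sup>2)"
    by auto
qed

lemma square_integrable_0: "square_integrable M (\<lambda>x. 0)"
  by (simp add: square_integrable_def)

lemma square_integrable_add:
  assumes "square_integrable M f" "square_integrable M g"
  shows "square_integrable M (\<lambda>x. f x + g x)"
proof -
  have "integrable M (\<lambda>x. (f x)\<^sup>2 + (g x)\<^sup>2 + 2 * (f x * g x))"
    using assms square_integrable_mult[OF assms]
    by (intro Bochner_Integration.integrable_add integrable_mult_right) (auto simp: square_integrable_def)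
  then have "integrable M (\<lambda>x. (f x + g x)\<^sup>2)"
    by (simp add: power2_sum mult.assoc)
  then show ?thesis
    using assms by (auto simp: square_integrable_def)
qed

lemma square_integrable_scale:
  "square_integrable M f \<Longrightarrow> square_integrable M (\<lambda>x. c * f x)"
  by (auto simp: square_integrable_def power_mult_distrib)

lemma square_integrable_uminus:
  "square_integrable M f \<Longrightarrow> square_integrable M (\<lambda>x. - f x)"
  by (auto simp: square_integrable_def)

lemma square_integrable_diff:
  "square_integrable M f \<Longrightarrow> square_integrable M g \<Longrightarrow> square_integrable M (\<lambda>x. f x - g x)"
  using square_integrable_add[OF _ square_integrable_uminus, of M f g] by simp

lemma square_integrable_iff_nn:
  "square_integrable M f \<longleftrightarrow>
    f \<in> borel_measurable M \<and> (\<integral>\<^sup>+x. ennreal ((f x)\<^sup>2) \<partial>M) < \<infinity>"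
  by (auto simp: square_integrable_def integrable_iff_bounded)

lemma square_integrable_limit:
  fixes f :: "nat \<Rightarrow> 'a \<Rightarrow> real"
  assumes f: "\<And>n. square_integrable M (f n)"
    and Cauchy: "\<And>e. e > 0 \<Longrightarrow> \<exists>N. \<forall>m\<ge>N. \<forall>n\<ge>N. (\<integral>x. (f m x - f n x)\<^sup>2 \<partial>M) < e"
    and r: "strict_mono r"
    and [measurable]: "g \<in> borel_measurable M"
    and lim: "AE x in M. (\<lambda>i. f (r i) x) \<longlonglongrightarrow> g x"
  shows "square_integrable M g"
    and "\<And>e. e > 0 \<Longrightarrow> \<exists>N. \<forall>n\<ge>N. (\<integral>x. (f n x - g x)\<^sup>2 \<partial>M) \<le> e"
proof -
  have [measurable]: "f n \<in> borel_measurable M" for n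
    using f by (simp add: square_integrable_def)
  have *: "\<exists>N. \<forall>n\<ge>N. (\<integral>\<^sup>+x. ennreal ((f n x - g x)\<^sup>2) \<partial>M) \<le> ennreal e" if "e > 0" for e
  proof -
    obtain N where N: "\<And>m n. m \<ge> N \<Longrightarrow> n \<ge> N \<Longrightarrow> (\<integral>x. (f m x - f n x)\<^sup>2 \<partial>M) < e"
      using Cauchy[OF \<open>e > 0\<close>] by blast
    have "(\<integral>\<^sup>+x. ennreal ((f n x - g x)\<^sup>2) \<partial>M) \<le> ennreal e" if "n \<ge> N" for n
    proof -
      have "(\<integral>\<^sup>+x. ennreal ((f n x - g x)\<^sup>2) \<partial>M)
          = (\<integral>\<^sup>+x. liminf (\<lambda>i. ennreal ((f n x - f (r i) x)\<^sup>2)) \<partial>M)"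
      proof (rule nn_integral_cong_AE)
        show "AE x in M. ennreal ((f n x - g x)\<^sup>2) = liminf (\<lambda>i. ennreal ((f n x - f (r i) x)\<^sup>2))"
          using lim
        proof eventually_elim
          case (elim x)
          then have "(\<lambda>i. ennreal ((f n x - f (r i) x)\<^sup>2)) \<longlonglongrightarrow> ennreal ((f n x - g x)\<^sup>2)"
            by (intro tendsto_intros)
          then show ?case
            by (rule lim_imp_Liminf[OF sequentially_bot, symmetric])
        qed
      qed
      also have "\<dots> \<le> liminf (\<lambda>i. \<integral>\<^sup>+x. ennreal ((f n x - f (r i) x)\<^sup>2) \<partial>M)"
        by (rule nn_integral_liminf) simp
      also have "\<dots> \<le> liminf (\<lambda>i::nat. ennreal e)"
      proof (rule Liminf_mono)
        have "(\<integral>\<^sup>+x. ennreal ((f n x - f (r i) x)\<^sup>2) \<partial>M) \<le> ennreal e" if "i \<ge> N" for i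
        proof -
          have "r i \<ge> N"
            using that strict_mono_imp_increasing[OF r, of i] by linarith
          then have "(\<integral>x. (f n x - f (r i) x)\<^sup>2 \<partial>M) < e"
            using N \<open>n \<ge> N\<close> by blast
          moreover have "(\<integral>\<^sup>+x. ennreal ((f n x - f (r i) x)\<^sup>2) \<partial>M)
              = ennreal (\<integral>x. (f n x - f (r i) x)\<^sup>2 \<partial>M)"
            using square_integrable_diff[OF f[of n] f[of "r i"]]
            by (intro nn_integral_eq_integral) (auto simp: square_integrable_def)
          ultimately show ?thesis
            by (simp add: ennreal_leI)
        qed
        then show "\<forall>\<^sub>F i in sequentially. (\<integral>\<^sup>+x. ennreal ((f n x - f (r i) x)\<^sup>2) \<partial>M) \<le> ennreal e"
          unfolding eventually_sequentially by blast
      qed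
      also have "\<dots> = ennreal e"
        by (simp add: Liminf_const)
      finally show ?thesis .
    qed
    then show ?thesis by blast
  qed
  have sq: "square_integrable M (\<lambda>x. f n x - g x)"
    if "(\<integral>\<^sup>+x. ennreal ((f n x - g x)\<^sup>2) \<partial>M) \<le> ennreal e" for n e
    using that by (auto simp: square_integrable_iff_nn intro: order_le_less_trans)
  obtain n where "(\<integral>\<^sup>+x. ennreal ((f n x - g x)\<^sup>2) \<partial>M) \<le> ennreal 1"
    using *[of 1] by fastforce
  from square_integrable_diff[OF f[of n] sq[OF this]]
  show "square_integrable M g" by simp
  fix e :: real assume "e > 0"
  then obtain N where N: "\<And>n. n \<ge> N \<Longrightarrow> (\<integral>\<^sup>+x. ennreal ((f n x - g x)\<^sup>2) \<partial>M) \<le> ennreal e"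
    using *[of e] by blast
  have "(\<integral>x. (f n x - g x)\<^sup>2 \<partial>M) \<le> e" if "n \<ge> N" for n
  proof -
    have "(\<integral>\<^sup>+x. ennreal ((f n x - g x)\<^sup>2) \<partial>M) = ennreal (\<integral>x. (f n x - g x)\<^sup>2 \<partial>M)"
      using sq[OF N[OF that]] by (intro nn_integral_eq_integral) (auto simp: square_integrable_def)
    with N[OF that] \<open>e > 0\<close> show ?thesis by simp
  qed
  then show "\<exists>N. \<forall>n\<ge>N. (\<integral>x. (f n x - g x)\<^sup>2 \<partial>M) \<le> e" by blast
qed

section \<open>The Hilbert space \<open>L\<^sup>2(0,1)\<close>\<close>

abbreviation lebesgue01 :: "real measure" where
  "lebesgue01 \<equiv> lebesgue_on {0<..<1}"

lemma finite_measure_lebesgue01: "finite_measure lebesgue01"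
  by (intro finite_measure_lebesgue_on) (simp add: bounded_set_imp_lmeasurable)

definition L2_rel :: "(real \<Rightarrow> real) \<Rightarrow> (real \<Rightarrow> real) \<Rightarrow> bool" where
  "L2_rel f g \<longleftrightarrow> square_integrable lebesgue01 f \<and> square_integrable lebesgue01 g \<and>
    (AE t in lebesgue01. f t = g t)"

lemma part_equivp_L2_rel: "part_equivp L2_rel"
proof (rule part_equivpI)
  show "\<exists>f. L2_rel f f"
    using square_integrable_0[of lebesgue01] by (auto simp: L2_rel_def)
  show "symp L2_rel"
    by (auto simp: symp_def L2_rel_def)
  show "transp L2_rel"
    unfolding transp_def L2_rel_def by (auto elim: AE_mp)
qed

quotient_type L2 = "real \<Rightarrow> real" / partial: L2_rel
  by (rule part_equivp_L2_rel)

instantiation L2 :: real_inner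
begin

lift_definition zero_L2 :: L2 is "\<lambda>t. 0"
  by (simp add: L2_rel_def square_integrable_0)

lift_definition plus_L2 :: "L2 \<Rightarrow> L2 \<Rightarrow> L2" is "\<lambda>f g t. f t + g t"
  unfolding L2_rel_def by (auto simp: square_integrable_add)

lift_definition uminus_L2 :: "L2 \<Rightarrow> L2" is "\<lambda>f t. - f t"
  unfolding L2_rel_def by (auto simp: square_integrable_uminus)

lift_definition minus_L2 :: "L2 \<Rightarrow> L2 \<Rightarrow> L2" is "\<lambda>f g t. f t - g t"
  unfolding L2_rel_def by (auto simp: square_integrable_diff)

lift_definition scaleR_L2 :: "real \<Rightarrow> L2 \<Rightarrow> L2" is "\<lambda>c f t. c * f t"
  unfolding L2_rel_def by (auto simp: square_integrable_scale)

lift_definition inner_L2 :: "L2 \<Rightarrow> L2 \<Rightarrow> real" is "\<lambda>f g. LINT t|lebesgue01. f t * g t"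
  unfolding L2_rel_def
  by (auto intro!: integral_cong_AE borel_measurable_times dest: square_integrable_measurable)

definition norm_L2 :: "L2 \<Rightarrow> real" where
  "norm_L2 x = sqrt (inner x x)"

definition sgn_L2 :: "L2 \<Rightarrow> L2" where
  "sgn_L2 x = inverse (norm x) *\<^sub>R x"

definition dist_L2 :: "L2 \<Rightarrow> L2 \<Rightarrow> real" where
  "dist_L2 x y = norm (x - y)"

definition uniformity_L2 :: "(L2 \<times> L2) filter" where
  "uniformity_L2 = (INF e\<in>{0<..}. principal {(x, y). dist x y < e})"

definition open_L2 :: "L2 set \<Rightarrow> bool" where
  "open_L2 U \<longleftrightarrow> (\<forall>x\<in>U. \<forall>\<^sub>F (x', y) in uniformity. x' = x \<longrightarrow> y \<in> U)"

instance
proof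
  fix x y z :: L2 and a b :: real and U :: "L2 set"
  show "x + y + z = x + (y + z)"
    by transfer (auto simp: L2_rel_def square_integrable_add add.assoc)
  show "x + y = y + x"
    by transfer (auto simp: L2_rel_def square_integrable_add add.commute)
  show "0 + x = x"
    by transfer (auto simp: L2_rel_def)
  show "- x + x = 0"
    by transfer (auto simp: L2_rel_def square_integrable_0)
  show "x - y = x + - y"
    by transfer (auto simp: L2_rel_def square_integrable_diff)
  show "a *\<^sub>R (x + y) = a *\<^sub>R x + a *\<^sub>R y"
    by transfer (auto simp: L2_rel_def square_integrable_add square_integrable_scale algebra_simps)
  show "(a + b) *\<^sub>R x = a *\<^sub>R x + b *\<^sub>R x"
    by transfer (auto simp: L2_rel_def square_integrable_add square_integrable_scale algebra_simps)
  show "a *\<^sub>R b *\<^sub>R x = (a * b) *\<^sub>R x"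
    by transfer (auto simp: L2_rel_def square_integrable_scale algebra_simps)
  show "1 *\<^sub>R x = x"
    by transfer (auto simp: L2_rel_def)
  show "inner x y = inner y x"
    by transfer (simp add: mult.commute)
  show "inner (x + y) z = inner x z + inner y z"
    by transfer (simp add: L2_rel_def distrib_right square_integrable_mult)
  show "inner (a *\<^sub>R x) y = a * inner x y"
    by transfer (simp add: mult.assoc)
  show "0 \<le> inner x x"
    by transfer simp
  show "inner x x = 0 \<longleftrightarrow> x = 0"
  proof transfer
    fix f assume "L2_rel f f"
    then have f: "square_integrable lebesgue01 f"
      by (simp add: L2_rel_def)
    have "(LINT t|lebesgue01. f t * f t) = 0 \<longleftrightarrow> (AE t in lebesgue01. f t * f t = 0)"
      using square_integrable_mult[OF f f] by (intro integral_nonneg_eq_0_iff_AE) auto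
    then show "(LINT t|lebesgue01. f t * f t) = 0 \<longleftrightarrow> L2_rel f (\<lambda>t. 0)"
      using f by (simp add: L2_rel_def square_integrable_0)
  qed
qed (simp_all add: norm_L2_def sgn_L2_def dist_L2_def uniformity_L2_def open_L2_def)

end

lemma dist_L2_abs:
  assumes "square_integrable lebesgue01 f" "square_integrable lebesgue01 g"
  shows "dist (abs_L2 f) (abs_L2 g) = sqrt (LINT t|lebesgue01. (f t - g t)\<^sup>2)"
proof -
  have "L2_rel f f" "L2_rel g g" "L2_rel (\<lambda>t. f t - g t) (\<lambda>t. f t - g t)"
    using assms by (auto simp: L2_rel_def square_integrable_diff)
  then show ?thesis
    by (simp add: dist_norm norm_eq_sqrt_inner minus_L2.abs_eq inner_L2.abs_eq power2_eq_square)
qed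

instance L2 :: complete_space
proof
  fix X :: "nat \<Rightarrow> L2" assume X: "Cauchy X"
  define f where "f n = rep_L2 (X n)" for n
  have "L2_rel (f n) (f n)" for n
    unfolding f_def by (rule Quotient_rep_reflp[OF Quotient_L2])
  then have f: "square_integrable lebesgue01 (f n)" for n
    by (simp add: L2_rel_def)
  have X_eq: "X n = abs_L2 (f n)" for n
    unfolding f_def by (simp add: Quotient_abs_rep[OF Quotient_L2])
  interpret finite_measure lebesgue01
    by (rule finite_measure_lebesgue01)
  have sq_Cauchy: "\<exists>N. \<forall>m\<ge>N. \<forall>n\<ge>N. (LINT t|lebesgue01. (f m t - f n t)\<^sup>2) < e" if "e > 0" for e
  proof -
    have "sqrt e > 0" using that by simp
    then obtain N where "\<forall>m\<ge>N. \<forall>n\<ge>N. dist (X m) (X n) < sqrt e"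
      using X unfolding Cauchy_def by blast
    then show ?thesis
      using f by (auto simp: X_eq dist_L2_abs)
  qed
  have int: "integrable lebesgue01 (f n)" for n
    using f[of n] by (auto simp: square_integrable_def intro: square_integrable_imp_integrable)
  have L1_Cauchy: "\<exists>N. \<forall>m\<ge>N. \<forall>n\<ge>N. (LINT t|lebesgue01. norm (f m t - f n t)) < e" if "e > 0" for e
  proof -
    have "e\<^sup>2 > 0" using that by simp
    then obtain N where N: "\<And>m n. m \<ge> N \<Longrightarrow> n \<ge> N \<Longrightarrow> (LINT t|lebesgue01. (f m t - f n t)\<^sup>2) < e\<^sup>2"
      using sq_Cauchy by blast
    have "(LINT t|lebesgue01. norm (f m t - f n t)) < e" if "m \<ge> N" "n \<ge> N" for m n
    proof -
      define h where "h t = \<bar>f m t - f n t\<bar>" for t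
      have h: "square_integrable lebesgue01 h"
        using square_integrable_diff[OF f f, of m n] unfolding square_integrable_def h_def by auto
      have one: "square_integrable lebesgue01 (\<lambda>t. 1)"
        by (simp add: square_integrable_def)
      have rel: "L2_rel h h" "L2_rel (\<lambda>t. 1) (\<lambda>t. 1)"
        using h one by (auto simp: L2_rel_def)
      have "norm (abs_L2 (\<lambda>t. 1)) = 1"
        using rel by (simp add: norm_eq_sqrt_inner inner_L2.abs_eq measure_restrict_space)
      moreover have "norm (abs_L2 h) < e"
        using N[OF that] \<open>e > 0\<close> rel
        by (simp add: norm_eq_sqrt_inner inner_L2.abs_eq h_def power2_eq_square real_less_lsqrt)
      moreover have "inner (abs_L2 h) (abs_L2 (\<lambda>t. 1)) = (LINT t|lebesgue01. norm (f m t - f n t))"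
        using rel by (simp add: inner_L2.abs_eq h_def)
      ultimately show ?thesis
        using norm_cauchy_schwarz[of "abs_L2 h" "abs_L2 (\<lambda>t. 1)"] by simp
    qed
    then show ?thesis by blast
  qed
  obtain r where r: "strict_mono r" and AE: "AE t in lebesgue01. Cauchy (\<lambda>i. f (r i) t)"
    using cauchy_L1_AE_cauchy_subseq[OF int L1_Cauchy] by blast
  define g where "g t = lim (\<lambda>i. f (r i) t)" for t
  have meas: "g \<in> borel_measurable lebesgue01"
    unfolding g_def using f by (intro borel_measurable_lim_metric) (auto simp: square_integrable_def)
  have lim: "AE t in lebesgue01. (\<lambda>i. f (r i) t) \<longlonglongrightarrow> g t"
    using AE by eventually_elim (simp add: g_def Cauchy_convergent_iff convergent_LIMSEQ_iff)
  have g: "square_integrable lebesgue01 g"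
    by (rule square_integrable_limit(1)[OF f sq_Cauchy r meas lim])
  have "X \<longlonglongrightarrow> abs_L2 g"
  proof (rule metric_LIMSEQ_I)
    fix e :: real assume "e > 0"
    then have "(e/2)\<^sup>2 > 0" by simp
    then obtain N where N: "\<forall>n\<ge>N. (LINT t|lebesgue01. (f n t - g t)\<^sup>2) \<le> (e/2)\<^sup>2"
      using square_integrable_limit(2)[OF f sq_Cauchy r meas lim] by blast
    have "dist (X n) (abs_L2 g) < e" if "n \<ge> N" for n
    proof -
      have "sqrt (LINT t|lebesgue01. (f n t - g t)\<^sup>2) \<le> e/2"
        using N that \<open>e > 0\<close> by (intro real_le_lsqrt) auto
      then show ?thesis
        using f g \<open>e > 0\<close> by (simp add: X_eq dist_L2_abs)
    qed
    then show "\<exists>N. \<forall>n\<ge>N. dist (X n) (abs_L2 g) < e" by blast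
  qed
  then show "convergent X"
    by (auto simp: convergent_def)
qed

section \<open>The Hilbert space \<open>\<ell>\<^sup>2\<close>\<close>

typedef ell2 = "{a :: nat \<Rightarrow> real. summable (\<lambda>i. (a i)\<^sup>2)}"
  morphisms ell2_nth Abs_ell2
  by (rule exI[of _ "\<lambda>i. 0"]) simp

setup_lifting type_definition_ell2

lemma ell2_iff_square_integrable:
  "summable (\<lambda>i. (a i)\<^sup>2) \<longleftrightarrow> square_integrable (count_space UNIV) a"
  by (simp add: square_integrable_def integrable_count_space_nat_iff)

lemma ell2_mult:
  fixes a b :: "nat \<Rightarrow> real"
  assumes "summable (\<lambda>i. (a i)\<^sup>2)" "summable (\<lambda>i. (b i)\<^sup>2)"
  shows "summable (\<lambda>i. a i * b i)"
  using square_integrable_mult[of "count_space UNIV" a b] assms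
  by (auto simp: ell2_iff_square_integrable integrable_count_space_nat_iff intro: summable_rabs_cancel)

instantiation ell2 :: real_inner
begin

lift_definition zero_ell2 :: ell2 is "\<lambda>i. 0"
  by simp

lift_definition plus_ell2 :: "ell2 \<Rightarrow> ell2 \<Rightarrow> ell2" is "\<lambda>a b i. a i + b i"
  by (simp add: ell2_iff_square_integrable square_integrable_add)

lift_definition uminus_ell2 :: "ell2 \<Rightarrow> ell2" is "\<lambda>a i. - a i"
  by simp

lift_definition minus_ell2 :: "ell2 \<Rightarrow> ell2 \<Rightarrow> ell2" is "\<lambda>a b i. a i - b i"
  by (simp add: ell2_iff_square_integrable square_integrable_diff)

lift_definition scaleR_ell2 :: "real \<Rightarrow> ell2 \<Rightarrow> ell2" is "\<lambda>c a i. c * a i"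
  by (simp add: ell2_iff_square_integrable square_integrable_scale)

lift_definition inner_ell2 :: "ell2 \<Rightarrow> ell2 \<Rightarrow> real" is "\<lambda>a b. \<Sum>i. a i * b i" .

definition norm_ell2 :: "ell2 \<Rightarrow> real" where
  "norm_ell2 x = sqrt (inner x x)"

definition sgn_ell2 :: "ell2 \<Rightarrow> ell2" where
  "sgn_ell2 x = inverse (norm x) *\<^sub>R x"

definition dist_ell2 :: "ell2 \<Rightarrow> ell2 \<Rightarrow> real" where
  "dist_ell2 x y = norm (x - y)"

definition uniformity_ell2 :: "(ell2 \<times> ell2) filter" where
  "uniformity_ell2 = (INF e\<in>{0<..}. principal {(x, y). dist x y < e})"

definition open_ell2 :: "ell2 set \<Rightarrow> bool" where
  "open_ell2 U \<longleftrightarrow> (\<forall>x\<in>U. \<forall>\<^sub>F (x', y) in uniformity. x' = x \<longrightarrow> y \<in> U)"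

instance
proof
  fix x y z :: ell2 and a b :: real and U :: "ell2 set"
  show "x + y + z = x + (y + z)" "x + y = y + x" "0 + x = x" "- x + x = 0" "x - y = x + - y"
    by (transfer; simp add: fun_eq_iff)+
  show "a *\<^sub>R (x + y) = a *\<^sub>R x + a *\<^sub>R y" "(a + b) *\<^sub>R x = a *\<^sub>R x + b *\<^sub>R x"
    "a *\<^sub>R b *\<^sub>R x = (a * b) *\<^sub>R x" "1 *\<^sub>R x = x"
    by (transfer; simp add: fun_eq_iff algebra_simps)+
  show "inner x y = inner y x"
    by transfer (simp add: mult.commute)
  show "inner (x + y) z = inner x z + inner y z"
    by transfer (simp add: distrib_right ell2_mult suminf_add)
  show "inner (a *\<^sub>R x) y = a * inner x y"
    by transfer (simp add: mult.assoc ell2_mult suminf_mult)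
  show "0 \<le> inner x x"
    by transfer (simp add: ell2_mult suminf_nonneg)
  show "inner x x = 0 \<longleftrightarrow> x = 0"
    by transfer (simp add: ell2_mult suminf_eq_zero_iff fun_eq_iff)
qed (simp_all add: norm_ell2_def sgn_ell2_def dist_ell2_def uniformity_ell2_def open_ell2_def)

end

lemma dist_ell2_eq: "dist x y = sqrt (\<integral>i. (ell2_nth x i - ell2_nth y i)\<^sup>2 \<partial>count_space UNIV)"
proof -
  have "integrable (count_space UNIV) (\<lambda>i. (ell2_nth x i - ell2_nth y i)\<^sup>2)"
    using ell2_nth[of "x - y"] by (simp add: minus_ell2.rep_eq integrable_count_space_nat_iff)
  then show ?thesis
    by (simp add: dist_norm norm_eq_sqrt_inner inner_ell2.rep_eq minus_ell2.rep_eq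
        integral_count_space_nat power2_eq_square)
qed

instance ell2 :: complete_space
proof
  fix X :: "nat \<Rightarrow> ell2" assume X: "Cauchy X"
  define f where "f n = ell2_nth (X n)" for n
  have f: "square_integrable (count_space UNIV) (f n)" for n
    using ell2_nth[of "X n"] by (simp add: f_def ell2_iff_square_integrable)
  have sq_Cauchy: "\<exists>N. \<forall>m\<ge>N. \<forall>n\<ge>N. (\<integral>i. (f m i - f n i)\<^sup>2 \<partial>count_space UNIV) < e" if "e > 0" for e
  proof -
    have "sqrt e > 0" using that by simp
    then obtain N where "\<forall>m\<ge>N. \<forall>n\<ge>N. dist (X m) (X n) < sqrt e"
      using X unfolding Cauchy_def by blast
    then show ?thesis
      by (auto simp: f_def dist_ell2_eq)
  qed
  have "Cauchy (\<lambda>n. f n i)" for i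
  proof (rule metric_CauchyI)
    fix e :: real assume "e > 0"
    then obtain N where N: "\<And>m n. m \<ge> N \<Longrightarrow> n \<ge> N \<Longrightarrow> dist (X m) (X n) < e"
      using X unfolding Cauchy_def by blast
    have "dist (f m i) (f n i) < e" if "m \<ge> N" "n \<ge> N" for m n
    proof -
      have sm: "summable (\<lambda>i. (f m i - f n i)\<^sup>2)"
        using square_integrable_diff[OF f f, of m n] by (simp add: ell2_iff_square_integrable)
      have "(f m i - f n i)\<^sup>2 \<le> (\<Sum>i. (f m i - f n i)\<^sup>2)"
        using sum_le_suminf[OF sm, of "{i}"] by simp
      then have "\<bar>f m i - f n i\<bar> \<le> sqrt (\<Sum>i. (f m i - f n i)\<^sup>2)"
        using real_sqrt_le_mono by fastforce
      also have "\<dots> = dist (X m) (X n)"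
        using sm by (simp add: dist_ell2_eq f_def integral_count_space_nat integrable_count_space_nat_iff)
      finally show ?thesis
        using N[OF that] by (simp add: dist_real_def)
    qed
    then show "\<exists>M. \<forall>m\<ge>M. \<forall>n\<ge>M. dist (f m i) (f n i) < e" by blast
  qed
  then have lim: "AE i in count_space UNIV. (\<lambda>n. f (id n) i) \<longlonglongrightarrow> lim (\<lambda>n. f n i)"
    by (simp add: Cauchy_convergent_iff convergent_LIMSEQ_iff)
  define g where "g i = lim (\<lambda>n. f n i)" for i
  have id: "strict_mono (id :: nat \<Rightarrow> nat)"
    by (simp add: strict_mono_def)
  have meas: "g \<in> borel_measurable (count_space UNIV)"
    by simp
  note limit = square_integrable_limit[OF f sq_Cauchy id meas lim[folded g_def]]
  have g: "ell2_nth (Abs_ell2 g) = g"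
    using limit(1) by (simp add: Abs_ell2_inverse ell2_iff_square_integrable)
  have "X \<longlonglongrightarrow> Abs_ell2 g"
  proof (rule metric_LIMSEQ_I)
    fix e :: real assume "e > 0"
    then have "(e/2)\<^sup>2 > 0" by simp
    then obtain N where N: "\<forall>n\<ge>N. (\<integral>i. (f n i - g i)\<^sup>2 \<partial>count_space UNIV) \<le> (e/2)\<^sup>2"
      using limit(2) by blast
    have "dist (X n) (Abs_ell2 g) < e" if "n \<ge> N" for n
    proof -
      have "sqrt (\<integral>i. (f n i - g i)\<^sup>2 \<partial>count_space UNIV) \<le> e/2"
        using N that \<open>e > 0\<close> by (intro real_le_lsqrt) auto
      then show ?thesis
        using \<open>e > 0\<close> by (simp add: g dist_ell2_eq f_def[symmetric])
    qed
    then show "\<exists>N. \<forall>n\<ge>N. dist (X n) (Abs_ell2 g) < e" by blast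
  qed
  then show "convergent X"
    by (auto simp: convergent_def)
qed

section \<open>The operators\<close>

lemma measurable_ident_lebesgue01 [measurable]: "(\<lambda>t. t) \<in> borel_measurable lebesgue01"
  by (intro measurable_restrict_space1) (simp add: measurable_completion)

lemma AE_lebesgue01: "AE t in lebesgue01. 0 < t \<and> t < 1"
  by (intro AE_I2) auto

lemma nn_integral_lebesgue01_has_integral:
  fixes f :: "real \<Rightarrow> real"
  assumes "(f has_integral I) \<Omega>" "\<And>t. t \<in> \<Omega> \<Longrightarrow> 0 \<le> f t"
  shows "(\<integral>\<^sup>+t. ennreal (f t) * indicator \<Omega> t \<partial>lebesgue01) \<le> ennreal I"
proof -
  have "(\<integral>\<^sup>+t. ennreal (f t) * indicator \<Omega> t \<partial>lebesgue01)
      \<le> (\<integral>\<^sup>+t. ennreal (f t) * indicator \<Omega> t \<partial>lebesgue)"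
    by (subst nn_integral_restrict_space) (auto intro!: nn_integral_mono simp: indicator_def)
  also have "\<dots> = ennreal I"
    using nn_integral_has_integral_lebesgue'[OF assms(2,1)] by (simp add: nn_integral_completion)
  finally show ?thesis .
qed

lemma ennreal_abs_integral_le:
  fixes f :: "'a \<Rightarrow> real"
  shows "ennreal \<bar>\<integral>x. f x \<partial>M\<bar> \<le> (\<integral>\<^sup>+x. ennreal \<bar>f x\<bar> \<partial>M)"
  using integral_norm_bound_ennreal[of M f]
  by (cases "integrable M f") (auto simp: not_integrable_integral_eq)

lemma Cauchy_Schwarz_abs_integral:
  fixes u v f :: "'a \<Rightarrow> real"
  assumes [measurable]: "u \<in> borel_measurable M" "v \<in> borel_measurable M"
    and "AE x in M. \<bar>f x\<bar> \<le> \<bar>u x * v x\<bar>"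
  shows "ennreal ((\<integral>x. f x \<partial>M)\<^sup>2)
    \<le> (\<integral>\<^sup>+x. ennreal ((u x)\<^sup>2) \<partial>M) * (\<integral>\<^sup>+x. ennreal ((v x)\<^sup>2) \<partial>M)"
proof -
  have "ennreal ((\<integral>x. f x \<partial>M)\<^sup>2) = (ennreal \<bar>\<integral>x. f x \<partial>M\<bar>)\<^sup>2"
    by (simp add: ennreal_power)
  also have "\<dots> \<le> (\<integral>\<^sup>+x. ennreal \<bar>f x\<bar> \<partial>M)\<^sup>2"
    by (intro power_mono ennreal_abs_integral_le) simp
  also have "\<dots> \<le> (\<integral>\<^sup>+x. ennreal \<bar>u x\<bar> * ennreal \<bar>v x\<bar> \<partial>M)\<^sup>2"
    using assms(3)
    by (intro power_mono nn_integral_mono_AE)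
      (auto simp: ennreal_mult[symmetric] abs_mult[symmetric] intro: ennreal_leI)
  also have "\<dots> \<le> (\<integral>\<^sup>+x. (ennreal \<bar>u x\<bar>)\<^sup>2 \<partial>M) * (\<integral>\<^sup>+x. (ennreal \<bar>v x\<bar>)\<^sup>2 \<partial>M)"
    by (rule Cauchy_Schwarz_nn_integral) auto
  finally show ?thesis
    by (simp add: ennreal_power)
qed

subsection \<open>The adjoint Cesaro operator\<close>

lemma integral_cesaro_eq:
  assumes "0 < t"
  shows "(LINT s|lebesgue_on {t<..<1}. x s / s)
    = (LINT s|lebesgue01. indicat_real {t<..<1} s * (x s / s))"
proof -
  have "indicat_real {0<..<1} s *\<^sub>R (indicat_real {t<..<1} s * (x s / s))
      = indicat_real {t<..<1} s *\<^sub>R (x s / s)" for s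
    using assms by (simp add: indicator_def)
  then show ?thesis
    by (simp add: integral_restrict_space del: real_scaleR_def)
qed

lemma cesaro_pointwise:
  assumes [measurable]: "x \<in> borel_measurable lebesgue01" and t: "0 < t" "t < 1"
  shows "ennreal ((LINT s|lebesgue_on {t<..<1}. x s / s)\<^sup>2)
    \<le> (\<integral>\<^sup>+s. ennreal (2 / sqrt t) * (ennreal ((x s)\<^sup>2 / sqrt s) * indicator {t<..<1} s) \<partial>lebesgue01)"
proof -
  define u where "u s = indicat_real {t<..<1} s * (x s / sqrt (sqrt s))" for s
  define v where "v s = indicat_real {t<..<1} s * (1 / (sqrt s * sqrt (sqrt s)))" for s
  have [measurable]: "u \<in> borel_measurable lebesgue01" "v \<in> borel_measurable lebesgue01"
    unfolding u_def v_def by measurable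
  have "sqrt (sqrt s) * (sqrt s * sqrt (sqrt s)) = s" if "s > 0" for s :: real
    using that by (simp add: mult.left_commute)
  then have uv: "indicat_real {t<..<1} s * (x s / s) = u s * v s" for s
    using t by (auto simp: u_def v_def indicator_def)
  have "ennreal ((LINT s|lebesgue_on {t<..<1}. x s / s)\<^sup>2)
      \<le> (\<integral>\<^sup>+s. ennreal ((u s)\<^sup>2) \<partial>lebesgue01) * (\<integral>\<^sup>+s. ennreal ((v s)\<^sup>2) \<partial>lebesgue01)"
    unfolding integral_cesaro_eq[OF t(1)] uv by (rule Cauchy_Schwarz_abs_integral) auto
  also have "(\<integral>\<^sup>+s. ennreal ((v s)\<^sup>2) \<partial>lebesgue01) \<le> ennreal (2 / sqrt t)"
  proof -
    have "((\<lambda>s. 1 / (s * sqrt s)) has_integral (- 2 / sqrt 1 - (- 2 / sqrt t))) {t..1}"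
    proof (rule fundamental_theorem_of_calculus_interior)
      show "continuous_on {t..1} (\<lambda>s. - 2 / sqrt s)"
        using t by (intro continuous_intros) auto
      show "((\<lambda>s. - 2 / sqrt s) has_vector_derivative 1 / (s * sqrt s)) (at s)" if "s \<in> {t<..<1}" for s
        unfolding has_real_derivative_iff_has_vector_derivative[symmetric]
        using that t by (auto intro!: derivative_eq_intros simp: field_simps)
    qed (use t in simp)
    then have "(\<integral>\<^sup>+s. ennreal (1 / (s * sqrt s)) * indicator {t..1} s \<partial>lebesgue01)
        \<le> ennreal (- 2 / sqrt 1 - (- 2 / sqrt t))"
      by (rule nn_integral_lebesgue01_has_integral) (use t in auto)
    also have "\<dots> \<le> ennreal (2 / sqrt t)"
      by (intro ennreal_leI) simp
    finally have *: "(\<integral>\<^sup>+s. ennreal (1 / (s * sqrt s)) * indicator {t..1} s \<partial>lebesgue01) \<le> ennreal (2 / sqrt t)" .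
    have "(\<integral>\<^sup>+s. ennreal ((v s)\<^sup>2) \<partial>lebesgue01)
        \<le> (\<integral>\<^sup>+s. ennreal (1 / (s * sqrt s)) * indicator {t..1} s \<partial>lebesgue01)"
      using t by (intro nn_integral_mono) (auto simp: v_def indicator_def power_divide power_mult_distrib)
    with * show ?thesis by simp
  qed
  also have "(\<integral>\<^sup>+s. ennreal ((u s)\<^sup>2) \<partial>lebesgue01)
      = (\<integral>\<^sup>+s. ennreal ((x s)\<^sup>2 / sqrt s) * indicator {t<..<1} s \<partial>lebesgue01)"
    using t by (intro nn_integral_cong) (auto simp: u_def indicator_def power_divide)
  finally show ?thesis
    by (simp add: nn_integral_cmult mult.commute mult_right_mono)
qed

lemma nn_integral_inverse_sqrt:
  assumes s: "0 < s" "s < 1"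
  shows "(\<integral>\<^sup>+t. ennreal (2 / sqrt t) * indicator {0..s} t \<partial>lebesgue01) \<le> ennreal (4 * sqrt s)"
proof (rule nn_integral_lebesgue01_has_integral)
  have "((\<lambda>t. 2 / sqrt t) has_integral (4 * sqrt s - 4 * sqrt 0)) {0..s}"
  proof (rule fundamental_theorem_of_calculus_interior)
    show "continuous_on {0..s} (\<lambda>t. 4 * sqrt t)"
      by (intro continuous_intros)
    show "((\<lambda>t. 4 * sqrt t) has_vector_derivative 2 / sqrt t) (at t)" if "t \<in> {0<..<s}" for t
      unfolding has_real_derivative_iff_has_vector_derivative[symmetric]
      using that by (auto intro!: derivative_eq_intros simp: field_simps)
  qed (use s in simp)
  then show "((\<lambda>t. 2 / sqrt t) has_integral (4 * sqrt s)) {0..s}" by simp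
qed auto

lemma square_integrable_cesaro_adj:
  assumes x: "square_integrable lebesgue01 x"
  shows "square_integrable lebesgue01 (\<lambda>t. LINT s|lebesgue_on {t<..<1}. x s / s)"
proof -
  interpret finite_measure lebesgue01
    by (rule finite_measure_lebesgue01)
  interpret P: pair_sigma_finite lebesgue01 lebesgue01
    by unfold_locales
  have [measurable]: "x \<in> borel_measurable lebesgue01"
    using x by (rule square_integrable_measurable)
  have fst_m [measurable]: "(\<lambda>p. fst p) \<in> borel_measurable (lebesgue01 \<Otimes>\<^sub>M lebesgue01)"
    by (rule measurable_compose[OF measurable_fst measurable_ident_lebesgue01])
  have snd_m [measurable]: "(\<lambda>p. snd p) \<in> borel_measurable (lebesgue01 \<Otimes>\<^sub>M lebesgue01)"
    by (rule measurable_compose[OF measurable_snd measurable_ident_lebesgue01])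
  have [measurable]: "(\<lambda>p. x (snd p)) \<in> borel_measurable (lebesgue01 \<Otimes>\<^sub>M lebesgue01)"
    by (rule measurable_compose[OF measurable_snd]) measurable
  have [measurable]: "Measurable.pred (lebesgue01 \<Otimes>\<^sub>M lebesgue01) (\<lambda>p. snd p \<in> {fst p<..<1})"
    unfolding greaterThanLessThan_iff
    using fst_m snd_m by (intro pred_intros_logic borel_measurable_less borel_measurable_const) auto
  have "(\<lambda>t. LINT s|lebesgue01. indicat_real {t<..<1} s * (x s / s)) \<in> borel_measurable lebesgue01"
    by (rule borel_measurable_lebesgue_integral) measurable
  then have meas: "(\<lambda>t. LINT s|lebesgue_on {t<..<1}. x s / s) \<in> borel_measurable lebesgue01"
    by (rule measurable_cong[THEN iffD1, rotated]) (simp add: integral_cesaro_eq)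
  have "(\<integral>\<^sup>+t. ennreal ((LINT s|lebesgue_on {t<..<1}. x s / s)\<^sup>2) \<partial>lebesgue01)
      \<le> (\<integral>\<^sup>+t. \<integral>\<^sup>+s. ennreal (2 / sqrt t) * (ennreal ((x s)\<^sup>2 / sqrt s) * indicator {t<..<1} s)
          \<partial>lebesgue01 \<partial>lebesgue01)"
    by (intro nn_integral_mono cesaro_pointwise) auto
  also have "\<dots> = (\<integral>\<^sup>+s. \<integral>\<^sup>+t. ennreal (2 / sqrt t) * (ennreal ((x s)\<^sup>2 / sqrt s) * indicator {t<..<1} s)
          \<partial>lebesgue01 \<partial>lebesgue01)"
    by (rule P.Fubini'[symmetric]) measurable
  also have "\<dots> \<le> (\<integral>\<^sup>+s. ennreal (4 * (x s)\<^sup>2) \<partial>lebesgue01)"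
  proof (rule nn_integral_mono)
    fix s assume "s \<in> space lebesgue01"
    then have s: "0 < s" "s < 1" by auto
    have "(\<integral>\<^sup>+t. ennreal (2 / sqrt t) * (ennreal ((x s)\<^sup>2 / sqrt s) * indicator {t<..<1} s) \<partial>lebesgue01)
        \<le> (\<integral>\<^sup>+t. ennreal ((x s)\<^sup>2 / sqrt s) * (ennreal (2 / sqrt t) * indicator {0..s} t) \<partial>lebesgue01)"
      by (intro nn_integral_mono) (auto simp: indicator_def mult.commute)
    also have "\<dots> = ennreal ((x s)\<^sup>2 / sqrt s) * (\<integral>\<^sup>+t. ennreal (2 / sqrt t) * indicator {0..s} t \<partial>lebesgue01)"
      by (intro nn_integral_cmult) measurable
    also have "\<dots> \<le> ennreal ((x s)\<^sup>2 / sqrt s) * ennreal (4 * sqrt s)"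
      using nn_integral_inverse_sqrt[OF s] by (intro mult_left_mono) auto
    also have "\<dots> = ennreal (4 * (x s)\<^sup>2)"
      using s by (simp add: ennreal_mult[symmetric] mult.commute)
    finally show "(\<integral>\<^sup>+t. ennreal (2 / sqrt t) * (ennreal ((x s)\<^sup>2 / sqrt s) * indicator {t<..<1} s)
        \<partial>lebesgue01) \<le> ennreal (4 * (x s)\<^sup>2)" .
  qed
  also have "\<dots> < \<infinity>"
    using square_integrable_scale[OF x, of 2] by (simp add: square_integrable_iff_nn power_mult_distrib)
  finally show ?thesis
    using meas by (simp add: square_integrable_iff_nn)
qed

lift_definition cesaro_adj :: "L2 \<Rightarrow> L2" is
  "\<lambda>x t. LINT s|lebesgue_on {t<..<1}. x s / s"
proof -
  fix x y assume "L2_rel x y"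
  then have x: "square_integrable lebesgue01 x" and y: "square_integrable lebesgue01 y"
    and AE: "AE s in lebesgue01. x s = y s"
    by (auto simp: L2_rel_def)
  have [measurable]: "x \<in> borel_measurable lebesgue01" "y \<in> borel_measurable lebesgue01"
    using x y by (auto dest: square_integrable_measurable)
  have "(LINT s|lebesgue_on {t<..<1}. x s / s) = (LINT s|lebesgue_on {t<..<1}. y s / s)"
    if "0 < t" for t
    unfolding integral_cesaro_eq[OF that] using AE by (intro integral_cong_AE) auto
  then show "L2_rel (\<lambda>t. LINT s|lebesgue_on {t<..<1}. x s / s)
      (\<lambda>t. LINT s|lebesgue_on {t<..<1}. y s / s)"
    using x y AE_lebesgue01 by (auto simp: L2_rel_def square_integrable_cesaro_adj)
qed

subsection \<open>The Hausdorff moment operator\<close>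

lemma Beta_half_le: "Beta (real j + 1) (1 / 2) \<le> Beta 1 (1 / 2) / sqrt (real j + 1)"
proof (induction j)
  case 0
  then show ?case by simp
next
  case (Suc j)
  have B: "Beta (real j + 1) (1/2) \<ge> 0" "Beta 1 (1/2 :: real) \<ge> 0"
    by (auto simp: Beta_def intro!: divide_nonneg_nonneg mult_nonneg_nonneg Gamma_real_nonneg)
  have "real j + 1 \<notin> \<int>\<^sub>\<le>\<^sub>0"
    by (auto elim!: nonpos_Ints_cases)
  then have "(real j + 1 + 1/2) * Beta (real j + 1 + 1) (1/2) = (real j + 1) * Beta (real j + 1) (1/2)"
    by (rule Beta_plus1_left)
  then have eq: "Beta (real (Suc j) + 1) (1/2) = (real j + 1) / (real j + 3/2) * Beta (real j + 1) (1/2)"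
    by (simp add: field_simps)
  have "((real j + 1) * sqrt (real j + 2))\<^sup>2 \<le> ((real j + 3/2) * sqrt (real j + 1))\<^sup>2"
    by (simp add: power_mult_distrib power2_eq_square algebra_simps)
  then have le: "(real j + 1) * sqrt (real j + 2) \<le> (real j + 3/2) * sqrt (real j + 1)"
    by (rule power2_le_imp_le) simp
  have "Beta (real (Suc j) + 1) (1/2)
      \<le> (real j + 1) / (real j + 3/2) * (Beta 1 (1/2) / sqrt (real j + 1))"
    unfolding eq by (intro mult_left_mono Suc) simp
  also have "\<dots> = Beta 1 (1/2) * ((real j + 1) / ((real j + 3/2) * sqrt (real j + 1)))"
    by simp
  also have "\<dots> \<le> Beta 1 (1/2) * (1 / sqrt (real j + 2))"
  proof (rule mult_left_mono)
    have "a / b \<le> 1 / c" if "a * c \<le> b" "0 < b" "0 < c" for a b c :: real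
      using that by (simp add: field_simps)
    from this[OF le] show "(real j + 1) / ((real j + 3/2) * sqrt (real j + 1)) \<le> 1 / sqrt (real j + 2)"
      by simp
  qed (rule B)
  finally show ?case by (simp add: add.commute)
qed

lemma nn_integral_power_inverse_sqrt:
  "(\<integral>\<^sup>+t. ennreal (t ^ j / sqrt (1 - t)) \<partial>lebesgue01) \<le> ennreal (Beta 1 (1/2) / sqrt (real j + 1))"
proof -
  have "((\<lambda>t. t powr (real j + 1 - 1) * (1 - t) powr (1/2 - 1)) has_integral Beta (real j + 1) (1/2)) {0..1}"
    by (rule has_integral_Beta_real) auto
  then have "(\<integral>\<^sup>+t. ennreal (t powr (real j + 1 - 1) * (1 - t) powr (1/2 - 1)) * indicator {0..1} t \<partial>lebesgue01)
      \<le> ennreal (Beta (real j + 1) (1/2))"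
    by (rule nn_integral_lebesgue01_has_integral) auto
  also have "\<dots> \<le> ennreal (Beta 1 (1/2) / sqrt (real j + 1))"
    by (intro ennreal_leI Beta_half_le)
  also have "(\<integral>\<^sup>+t. ennreal (t powr (real j + 1 - 1) * (1 - t) powr (1/2 - 1)) * indicator {0..1} t \<partial>lebesgue01)
      = (\<integral>\<^sup>+t. ennreal (t ^ j / sqrt (1 - t)) \<partial>lebesgue01)"
  proof (rule nn_integral_cong)
    fix t assume "t \<in> space lebesgue01"
    then have t: "0 < t" "t < 1" by auto
    have "(1 - t) powr (1/2 - 1) = 1 / sqrt (1 - t)"
      using t powr_minus_divide[of "1 - t" "1/2"] by (simp add: powr_half_sqrt)
    then show "ennreal (t powr (real j + 1 - 1) * (1 - t) powr (1/2 - 1)) * indicator {0..1} t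
        = ennreal (t ^ j / sqrt (1 - t))"
      using t by (simp add: powr_realpow)
  qed
  finally show ?thesis .
qed

lemma gchoose_half_ge:
  "(- 1 / 2 gchoose n) * (- 1) ^ n \<ge> (1 / (2 * sqrt (real n + 1)) :: real)"
proof -
  define c :: "nat \<Rightarrow> real" where "c n = (- 1 / 2 gchoose n) * (- 1) ^ n" for n
  have Suc_c: "c (Suc n) = c n * ((real n + 1/2) / (real n + 1))" for n
  proof -
    have "(- 1 / 2 gchoose Suc n) = - ((real n + 1/2) / (real n + 1)) * (- 1 / 2 gchoose n :: real)"
      using gbinomial_mult_1[of "- 1 / 2 :: real" n] by (simp add: field_simps)
    then show ?thesis
      unfolding c_def by simp
  qed
  have *: "c (Suc n) \<ge> 1 / (2 * sqrt (real n + 1))" for n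
  proof (induction n)
    case 0
    then show ?case by (simp add: c_def)
  next
    case (Suc n)
    have "((real n + 2) * sqrt (real n + 1))\<^sup>2 \<le> ((real n + 3/2) * sqrt (real n + 2))\<^sup>2"
      by (simp add: power_mult_distrib power2_eq_square algebra_simps)
    then have le: "(real n + 2) * sqrt (real n + 1) \<le> (real n + 3/2) * sqrt (real n + 2)"
      by (rule power2_le_imp_le) simp
    have "1 / (2 * sqrt (real n + 2)) \<le> 1 / (2 * sqrt (real n + 1)) * ((real n + 3/2) / (real n + 2))"
      using le by (simp add: divide_simps) (simp add: algebra_simps)
    also have "\<dots> \<le> c (Suc n) * ((real n + 3/2) / (real n + 2))"
      by (intro mult_right_mono Suc) simp
    also have "\<dots> = c (Suc (Suc n))"
      by (subst Suc_c[of "Suc n"]) (simp add: algebra_simps)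
    finally show ?case by (simp add: add.commute)
  qed
  have "c n \<ge> 1 / (2 * sqrt (real n + 1))"
  proof (cases n)
    case 0
    then show ?thesis by (simp add: c_def)
  next
    case (Suc m)
    have "1 / (2 * sqrt (real n + 1)) \<le> 1 / (2 * sqrt (real m + 1))"
      using Suc by (intro divide_left_mono) auto
    with *[of m] Suc show ?thesis by simp
  qed
  then show ?thesis by (simp add: c_def)
qed

lemma suminf_power_inverse_sqrt:
  fixes t :: real
  assumes t: "0 < t" "t < 1"
  shows "(\<Sum>j. ennreal (t ^ j / sqrt (real j + 1))) \<le> ennreal (2 / sqrt (1 - t))"
proof -
  define c :: "nat \<Rightarrow> real" where "c n = (- 1 / 2 gchoose n) * (- 1) ^ n" for n
  have c: "c n \<ge> 1 / (2 * sqrt (real n + 1))" for n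
    unfolding c_def by (rule gchoose_half_ge)
  then have c0: "c n \<ge> 0" for n
    by (rule order_trans[rotated]) simp
  have "(\<lambda>n. (- 1 / 2 gchoose n) * (- t) ^ n) sums (1 + - t) powr (- 1 / 2)"
    using t by (intro gen_binomial_real) auto
  moreover have "(- 1 / 2 gchoose n) * (- t) ^ n = c n * t ^ n" for n
    using power_mult_distrib[of "-1" t n] by (simp add: c_def)
  ultimately have "(\<lambda>n. c n * t ^ n) sums (1 / sqrt (1 - t))"
    using t powr_minus_divide[of "1 - t" "1/2"] by (simp add: powr_half_sqrt)
  then have sums: "(\<lambda>n. 2 * (c n * t ^ n)) sums (2 * (1 / sqrt (1 - t)))"
    by (rule sums_mult)
  have "(\<Sum>j. ennreal (t ^ j / sqrt (real j + 1))) \<le> (\<Sum>j. ennreal (2 * (c j * t ^ j)))"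
  proof (intro suminf_le summableI ennreal_leI)
    fix j
    have "t ^ j / sqrt (real j + 1) = 2 * (1 / (2 * sqrt (real j + 1)) * t ^ j)"
      by simp
    also have "\<dots> \<le> 2 * (c j * t ^ j)"
      using c[of j] t by (intro mult_left_mono mult_right_mono) auto
    finally show "t ^ j / sqrt (real j + 1) \<le> 2 * (c j * t ^ j)" .
  qed
  also have "\<dots> = ennreal (2 * (1 / sqrt (1 - t)))"
    using c0 t sums by (intro suminf_ennreal_eq) auto
  finally show ?thesis by simp
qed

lemma summable_hausdorff:
  assumes x: "square_integrable lebesgue01 x"
  shows "summable (\<lambda>j. (LINT t|lebesgue01. x t * t ^ j)\<^sup>2)"
proof (rule summable_suminf_not_top)
  define B :: real where "B = Beta 1 (1/2)"
  have B: "B \<ge> 0"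
    by (auto simp: B_def Beta_def intro!: divide_nonneg_nonneg mult_nonneg_nonneg Gamma_real_nonneg)
  have [measurable]: "x \<in> borel_measurable lebesgue01"
    using x by (rule square_integrable_measurable)
  have moment: "ennreal ((LINT t|lebesgue01. x t * t ^ j)\<^sup>2)
      \<le> (\<integral>\<^sup>+t. ennreal (B * (x t)\<^sup>2 * sqrt (1 - t)) * ennreal (t ^ j / sqrt (real j + 1)) \<partial>lebesgue01)" for j
  proof -
    define u where "u t = x t * sqrt (t ^ j) * sqrt (sqrt (1 - t))" for t
    define v where "v t = sqrt (t ^ j) / sqrt (sqrt (1 - t))" for t
    have [measurable]: "u \<in> borel_measurable lebesgue01" "v \<in> borel_measurable lebesgue01"
      unfolding u_def v_def by measurable
    have "ennreal ((LINT t|lebesgue01. x t * t ^ j)\<^sup>2)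
        \<le> (\<integral>\<^sup>+t. ennreal ((u t)\<^sup>2) \<partial>lebesgue01) * (\<integral>\<^sup>+t. ennreal ((v t)\<^sup>2) \<partial>lebesgue01)"
    proof (rule Cauchy_Schwarz_abs_integral)
      show "AE t in lebesgue01. \<bar>x t * t ^ j\<bar> \<le> \<bar>u t * v t\<bar>"
        using AE_lebesgue01
      proof eventually_elim
        case (elim t)
        then have "u t * v t = x t * (sqrt (t ^ j) * sqrt (t ^ j))"
          by (simp add: u_def v_def)
        with elim show ?case by simp
      qed
    qed auto
    also have "(\<integral>\<^sup>+t. ennreal ((v t)\<^sup>2) \<partial>lebesgue01) = (\<integral>\<^sup>+t. ennreal (t ^ j / sqrt (1 - t)) \<partial>lebesgue01)"
      by (intro nn_integral_cong) (simp add: v_def power_divide)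
    also have "\<dots> \<le> ennreal (B / sqrt (real j + 1))"
      unfolding B_def by (rule nn_integral_power_inverse_sqrt)
    also have "(\<integral>\<^sup>+t. ennreal ((u t)\<^sup>2) \<partial>lebesgue01) * ennreal (B / sqrt (real j + 1))
        = (\<integral>\<^sup>+t. ennreal ((u t)\<^sup>2) * ennreal (B / sqrt (real j + 1)) \<partial>lebesgue01)"
      by (simp add: nn_integral_multc)
    also have "\<dots> = (\<integral>\<^sup>+t. ennreal (B * (x t)\<^sup>2 * sqrt (1 - t)) * ennreal (t ^ j / sqrt (real j + 1)) \<partial>lebesgue01)"
      using B by (intro nn_integral_cong)
        (auto simp: u_def power_mult_distrib ennreal_mult[symmetric] mult_ac)
    finally show ?thesis by (simp add: mult_left_mono)
  qed
  have "(\<Sum>j. ennreal ((LINT t|lebesgue01. x t * t ^ j)\<^sup>2))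
      \<le> (\<Sum>j. \<integral>\<^sup>+t. ennreal (B * (x t)\<^sup>2 * sqrt (1 - t)) * ennreal (t ^ j / sqrt (real j + 1)) \<partial>lebesgue01)"
    by (intro suminf_le summableI moment)
  also have "\<dots> = (\<integral>\<^sup>+t. (\<Sum>j. ennreal (B * (x t)\<^sup>2 * sqrt (1 - t)) * ennreal (t ^ j / sqrt (real j + 1))) \<partial>lebesgue01)"
    by (intro nn_integral_suminf[symmetric]) measurable
  also have "\<dots> \<le> (\<integral>\<^sup>+t. ennreal (2 * B * (x t)\<^sup>2) \<partial>lebesgue01)"
  proof (rule nn_integral_mono)
    fix t assume "t \<in> space lebesgue01"
    then have t: "0 < t" "t < 1" by auto
    have "(\<Sum>j. ennreal (B * (x t)\<^sup>2 * sqrt (1 - t)) * ennreal (t ^ j / sqrt (real j + 1)))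
        = ennreal (B * (x t)\<^sup>2 * sqrt (1 - t)) * (\<Sum>j. ennreal (t ^ j / sqrt (real j + 1)))"
      by simp
    also have "\<dots> \<le> ennreal (B * (x t)\<^sup>2 * sqrt (1 - t)) * ennreal (2 / sqrt (1 - t))"
      by (intro mult_left_mono suminf_power_inverse_sqrt t) simp
    also have "\<dots> = ennreal (2 * B * (x t)\<^sup>2)"
      using t B by (simp add: ennreal_mult[symmetric] mult_ac)
    finally show "(\<Sum>j. ennreal (B * (x t)\<^sup>2 * sqrt (1 - t)) * ennreal (t ^ j / sqrt (real j + 1)))
        \<le> ennreal (2 * B * (x t)\<^sup>2)" .
  qed
  also have "\<dots> < \<infinity>"
    using square_integrable_scale[OF x, of "sqrt (2 * B)"] B
    by (simp add: square_integrable_iff_nn power_mult_distrib)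
  finally show "(\<Sum>j. ennreal ((LINT t|lebesgue01. x t * t ^ j)\<^sup>2)) \<noteq> top"
    by simp
qed simp

text \<open>
  Sequences in \<^typ>\<open>ell2\<close> start at index 0, so the entry with index \<open>j\<close> is the moment that is
  numbered \<open>j + 1\<close> when counting from 1.
\<close>

lift_definition hausdorff :: "L2 \<Rightarrow> ell2" is
  "\<lambda>x j. LINT t|lebesgue01. x t * t ^ j"
proof -
  fix x y assume "L2_rel x y"
  then have x: "square_integrable lebesgue01 x" and y: "square_integrable lebesgue01 y"
    and AE: "AE s in lebesgue01. x s = y s"
    by (auto simp: L2_rel_def)
  have [measurable]: "x \<in> borel_measurable lebesgue01" "y \<in> borel_measurable lebesgue01"
    using x y by (auto dest: square_integrable_measurable)
  have "(\<lambda>j. LINT t|lebesgue01. x t * t ^ j) = (\<lambda>j. LINT t|lebesgue01. y t * t ^ j)"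
    using AE by (intro ext integral_cong_AE) auto
  then show "summable (\<lambda>j. (LINT t|lebesgue01. x t * t ^ j)\<^sup>2) \<and>
      (\<lambda>j. LINT t|lebesgue01. x t * t ^ j) = (\<lambda>j. LINT t|lebesgue01. y t * t ^ j)"
    using summable_hausdorff[OF x] by simp
qed

section \<open>Compact and Hilbert--Schmidt operators\<close>

text \<open>
  In \<open>hilbert_schmidt\<close> the convergence of the sum does not depend on which orthonormal basis of
  the Hilbert space is taken, and every Hilbert space has one.
\<close>

definition compact_operator :: "('a::real_normed_vector \<Rightarrow> 'b::real_normed_vector) \<Rightarrow> bool" where
  "compact_operator T \<longleftrightarrow>
    bounded_linear T \<and> (\<forall>B. bounded B \<longrightarrow> compact (closure (T ` B)))"

definition orthonormal_basis :: "'a::{real_inner, complete_space} set \<Rightarrow> bool" where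
  "orthonormal_basis E \<longleftrightarrow>
    pairwise orthogonal E \<and> (\<forall>e\<in>E. norm e = 1) \<and> closure (span E) = UNIV"

definition hilbert_schmidt ::
    "('a::{real_inner, complete_space} \<Rightarrow> 'b::{real_inner, complete_space}) \<Rightarrow> bool" where
  "hilbert_schmidt T \<longleftrightarrow>
    bounded_linear T \<and> (\<exists>E. orthonormal_basis E \<and> (\<lambda>e. (norm (T e))\<^sup>2) summable_on E)"

end

theory Submission
  imports Defs
begin

text \<open>
  By Fubini, \<open>[H C\<^sup>* x]\<^sub>j = \<integral> t\<^sup>j \<integral>\<^sub>t\<^sup>1 x(s)/s ds dt = \<integral> x(s) s\<^sup>j/(j+1) ds\<close>, where \<open>j\<close> counts from 0. So the
  \<open>j\<close>-th entry of \<open>T x\<close> is the inner product of \<open>x\<close> with \<open>k\<^sub>j(s) = s\<^sup>j/(j+1)\<close>, and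
  \<open>\<Sum>\<^sub>j \<parallel>k\<^sub>j\<parallel>\<^sup>2 \<le> \<Sum>\<^sub>j 1/(j+1)\<^sup>2\<close> is finite. Summing Bessel's inequality for the \<open>k\<^sub>j\<close> shows that \<open>T\<close>
  is Hilbert--Schmidt. It is compact because it maps bounded sets into Hilbert cubes
  \<open>{a. \<bar>a\<^sub>j\<bar> \<le> M \<parallel>k\<^sub>j\<parallel>}\<close>.
\<close>

section \<open>Orthonormal sets\<close>

text \<open>The points of \<open>S\<close> that almost attain the infimum \<open>d\<close> of the
  squared distance form nested closed nonempty sets \<open>N n\<close>. The parallelogram law makes
  their diameters tend to 0, so completeness gives a common point.\<close>

lemma closed_subspace_nearest_point:
  fixes S :: "'a::{real_inner, complete_space} set"
  assumes "closed S" "subspace S"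
  obtains y where "y \<in> S" "\<And>z. z \<in> S \<Longrightarrow> norm (x - y) \<le> norm (x - z)"
proof -
  define d where "d = Inf ((\<lambda>y. (norm (x - y))\<^sup>2) ` S)"
  have "0 \<in> S" using assms(2) by (rule subspace_0)
  have bdd: "bdd_below ((\<lambda>y. (norm (x - y))\<^sup>2) ` S)"
    by (rule bdd_belowI[of _ 0]) auto
  have d_le: "d \<le> (norm (x - y))\<^sup>2" if "y \<in> S" for y
    unfolding d_def using that by (intro cInf_lower bdd) auto
  define N where "N n = {y \<in> S. (norm (x - y))\<^sup>2 \<le> d + 1 / (real n + 1)}" for n
  obtain y where y: "\<And>n. y \<in> N n"
  proof (rule decreasing_closed_nest[of N])
    show "closed (N n)" for n
    proof -
      have "closed {y. (norm (x - y))\<^sup>2 \<le> d + 1 / (real n + 1)}"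
        by (intro closed_Collect_le continuous_intros)
      moreover have "N n = S \<inter> {y. (norm (x - y))\<^sup>2 \<le> d + 1 / (real n + 1)}"
        by (auto simp: N_def)
      ultimately show ?thesis using assms(1) by auto
    qed
    show "N n \<noteq> {}" for n
    proof -
      have "\<exists>y\<in>S. (norm (x - y))\<^sup>2 < d + 1 / (real n + 1)"
        using cInf_lessD[of "(\<lambda>y. (norm (x - y))\<^sup>2) ` S" "d + 1 / (real n + 1)"] \<open>0 \<in> S\<close>
        by (fastforce simp: d_def)
      then show ?thesis by (auto simp: N_def intro: less_imp_le)
    qed
    show "N n \<subseteq> N m" if "m \<le> n" for m n
    proof -
      have "1 / (real n + 1) \<le> 1 / (real m + 1)"
        using that by (intro divide_left_mono) auto
      then show ?thesis by (auto simp: N_def)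
    qed
    fix e :: real assume "e > 0"
    \<comment> \<open>The parallelogram law below bounds the squared distance of two points of
      \<open>N n\<close> by 4 (d + 1/(n+1)) - 4 d = 4/(n+1); hence the factor 1/4.\<close>
    then obtain n where n: "1 / (real n + 1) < e\<^sup>2 / 4"
      using reals_Archimedean[of "e\<^sup>2 / 4"] by (auto simp: inverse_eq_divide add.commute)
    have "dist y z < e" if "y \<in> N n" "z \<in> N n" for y z
    proof -
      \<comment> \<open>The midpoint stays in the subspace, so its squared distance to
        \<open>x\<close> is at least \<open>d\<close>. This bounds the negative term of the
        parallelogram law.\<close>
      have "(1/2) *\<^sub>R (y + z) \<in> S"
        using that assms(2) by (auto simp: N_def intro!: subspace_scale subspace_add)
      then have "d \<le> (norm (x - (1/2) *\<^sub>R (y + z)))\<^sup>2"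
        by (rule d_le)
      moreover have "(norm (y - z))\<^sup>2 = 2 * (norm (x - y))\<^sup>2 + 2 * (norm (x - z))\<^sup>2
          - 4 * (norm (x - (1/2) *\<^sub>R (y + z)))\<^sup>2"
        by (simp add: power2_norm_eq_inner algebra_simps inner_commute)
      moreover have "(norm (x - y))\<^sup>2 \<le> d + 1 / (real n + 1)" "(norm (x - z))\<^sup>2 \<le> d + 1 / (real n + 1)"
        using that by (auto simp: N_def)
      ultimately have "(norm (y - z))\<^sup>2 < e\<^sup>2"
        using n by linarith
      then show ?thesis
        using \<open>e > 0\<close> by (auto simp: dist_norm intro: power_less_imp_less_base)
    qed
    then show "\<exists>n. \<forall>y\<in>N n. \<forall>z\<in>N n. dist y z < e" by blast
  qed blast
  have "(norm (x - y))\<^sup>2 \<le> d"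
  proof (rule field_le_epsilon)
    fix e :: real assume "e > 0"
    then obtain n where "1 / (real n + 1) < e"
      using reals_Archimedean[of e] by (auto simp: inverse_eq_divide add.commute)
    with y[of n] show "(norm (x - y))\<^sup>2 \<le> d + e"
      by (simp add: N_def)
  qed
  then have "norm (x - y) \<le> norm (x - z)" if "z \<in> S" for z
    using d_le[OF that] by (rule power2_le_imp_le[OF order_trans]) simp
  with y show thesis by (auto simp: N_def intro: that)
qed

text \<open>Moving from \<open>y\<close> along \<open>w\<close> stays in \<open>S\<close>; if x - y
  had a component along \<open>w\<close>, removing it would shorten the distance.\<close>

lemma orthogonal_nearest_point:
  fixes S :: "'a::real_inner set"
  assumes "subspace S" "y \<in> S" "\<And>z. z \<in> S \<Longrightarrow> norm (x - y) \<le> norm (x - z)" "w \<in> S"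
  shows "orthogonal (x - y) w"
proof (cases "w = 0")
  case False
  \<comment> \<open>This \<open>c\<close> minimizes the norm of (x - y) - c w: it is the coefficient
    of the projection of x - y onto \<open>w\<close>.\<close>
  define c where "c = inner (x - y) w / inner w w"
  have "y + c *\<^sub>R w \<in> S"
    using assms by (intro subspace_add subspace_scale)
  then have "(norm (x - y))\<^sup>2 \<le> (norm (x - (y + c *\<^sub>R w)))\<^sup>2"
    using assms(3) by (intro power_mono) auto
  also have "x - (y + c *\<^sub>R w) = (x - y) - c *\<^sub>R w" by simp
  also have "(norm ((x - y) - c *\<^sub>R w))\<^sup>2 = (norm (x - y))\<^sup>2 - 2 * c * inner (x - y) w + c\<^sup>2 * inner w w"
    unfolding power2_norm_eq_inner
    \<comment> \<open>These instances split only the outer difference, so that \<open>x - y\<close>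
      stays whole.\<close>
    by (simp only: inner_diff_left[of "x - y"] inner_diff_right[of _ "x - y"])
      (simp add: inner_commute power2_eq_square)
  also have "\<dots> = (norm (x - y))\<^sup>2 - (inner (x - y) w)\<^sup>2 / inner w w"
    using False by (simp add: c_def power2_eq_square)
  finally have "(inner (x - y) w)\<^sup>2 / inner w w \<le> 0" by simp
  moreover have "inner w w > 0" using False by simp
  ultimately have "(inner (x - y) w)\<^sup>2 \<le> 0"
    by (simp add: divide_le_0_iff not_less)
  then show ?thesis by (simp add: orthogonal_def)
qed (simp add: orthogonal_clauses)

lemma subspace_closure:
  fixes S :: "'a::real_normed_vector set"
  assumes "subspace S"
  shows "subspace (closure S)"
proof (rule subspaceI)
  show "0 \<in> closure S"
    using subspace_0[OF assms] closure_subset by blast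
  show "x + y \<in> closure S" if "x \<in> closure S" "y \<in> closure S" for x y
  proof -
    obtain f where "\<forall>n. f n \<in> S" "f \<longlonglongrightarrow> x"
      using \<open>x \<in> closure S\<close> unfolding closure_sequential by blast
    moreover obtain g where "\<forall>n. g n \<in> S" "g \<longlonglongrightarrow> y"
      using \<open>y \<in> closure S\<close> unfolding closure_sequential by blast
    ultimately show ?thesis
      unfolding closure_sequential
      by (intro exI[of _ "\<lambda>n. f n + g n"]) (auto intro: tendsto_add subspace_add[OF assms])
  qed
  show "c *\<^sub>R x \<in> closure S" if "x \<in> closure S" for c x
  proof -
    obtain f where "\<forall>n. f n \<in> S" "f \<longlonglongrightarrow> x"
      using \<open>x \<in> closure S\<close> unfolding closure_sequential by blast
    then show ?thesis
      unfolding closure_sequential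
      by (intro exI[of _ "\<lambda>n. c *\<^sub>R f n"]) (auto intro: tendsto_scaleR subspace_scale[OF assms])
  qed
qed

text \<open>Supplies the witness that \<open>hilbert_schmidt\<close> asks for. Zorn's lemma gives a
  maximal orthonormal set; a point outside the closure of its span would yield a further unit vector
  orthogonal to it.\<close>

lemma orthonormal_basis_exists:
  "\<exists>E :: 'a::{real_inner, complete_space} set. orthonormal_basis E"
proof -
  define A where "A = {E :: 'a set. pairwise orthogonal E \<and> (\<forall>e\<in>E. norm e = 1)}"
  have "\<Union>C \<in> A" if "subset.chain A C" for C
  proof -
    \<comment> \<open>Any two elements of the union already lie in one common member of the
      chain.\<close>
    have "pairwise orthogonal (\<Union>C)"
      using that by (intro pairwise_chain_Union) (auto simp: A_def subset_chain_def chain_subset_def)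
    then show ?thesis
      using that by (auto simp: A_def subset_chain_def)
  qed
  then obtain E where E: "E \<in> A" and max: "\<And>X. X \<in> A \<Longrightarrow> E \<subseteq> X \<Longrightarrow> X = E"
    using subset_Zorn'[of A] by metis
  have "x \<in> closure (span E)" for x
  proof -
    have S: "closed (closure (span E))" "subspace (closure (span E))"
      by (auto intro: subspace_closure)
    obtain y where y: "y \<in> closure (span E)"
      and near: "\<And>z. z \<in> closure (span E) \<Longrightarrow> norm (x - y) \<le> norm (x - z)"
      using closed_subspace_nearest_point[OF S] by metis
    have orth: "orthogonal (x - y) e" if "e \<in> E" for e
      using S(2) y near closure_subset[THEN subsetD, OF span_base[OF that]]
      by (rule orthogonal_nearest_point)
    have "x = y"
    proof (rule ccontr)
      assume "x \<noteq> y"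
      define u where "u = (1 / norm (x - y)) *\<^sub>R (x - y)"
      have u: "norm u = 1" "\<And>e. e \<in> E \<Longrightarrow> orthogonal u e"
        using \<open>x \<noteq> y\<close> orth by (auto simp: u_def orthogonal_clauses)
      then have "insert u E \<in> A"
        using E by (auto simp: A_def pairwise_insert orthogonal_commute)
      \<comment> \<open>Maximality puts \<open>u\<close> into \<open>E\<close>, so \<open>u\<close>
        is orthogonal to itself, against its norm being 1.\<close>
      then have "u \<in> E" using max by blast
      then have "orthogonal u u" using u(2) by blast
      with u(1) show False by (auto simp: orthogonal_def)
    qed
    with y show ?thesis by simp
  qed
  with E have "orthonormal_basis E"
    by (auto simp: orthonormal_basis_def A_def)
  then show ?thesis by blast
qed

text \<open>With \<open>p\<close> the projection of \<open>x\<close> onto the span of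
  \<open>F\<close>, both the squared norm of \<open>p\<close> and \<open>inner x p\<close> equal the
  sum, so the squared norm of x - p is the right side minus the left.\<close>

lemma Bessel_inequality:
  fixes x :: "'a::real_inner"
  assumes "finite F" "pairwise orthogonal F" "\<And>e. e \<in> F \<Longrightarrow> norm e = 1"
  shows "(\<Sum>e\<in>F. (inner x e)\<^sup>2) \<le> (norm x)\<^sup>2"
proof -
  define p where "p = (\<Sum>e\<in>F. inner x e *\<^sub>R e)"
  have "(norm p)\<^sup>2 = (\<Sum>e\<in>F. (norm (inner x e *\<^sub>R e))\<^sup>2)"
    unfolding p_def using assms(1,2)
    by (intro norm_sum_Pythagorean) (auto simp: pairwise_def orthogonal_clauses)
  also have "\<dots> = (\<Sum>e\<in>F. (inner x e)\<^sup>2)"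
    using assms(3) by simp
  finally have p: "(norm p)\<^sup>2 = (\<Sum>e\<in>F. (inner x e)\<^sup>2)" .
  have xp: "inner x p = (\<Sum>e\<in>F. (inner x e)\<^sup>2)"
    by (simp add: p_def inner_sum_right power2_eq_square)
  have "0 \<le> (norm (x - p))\<^sup>2" by simp
  also have "\<dots> = (norm x)\<^sup>2 - 2 * inner x p + (norm p)\<^sup>2"
    by (simp add: power2_norm_eq_inner algebra_simps inner_commute)
  finally show ?thesis
    by (simp add: p xp)
qed

section \<open>Operators into \<open>\<ell>\<^sup>2\<close> with square-summable rows\<close>

lemma summable_ell2_nth: "summable (\<lambda>j. (ell2_nth a j)\<^sup>2)"
  using ell2_nth[of a] by simp

lemma norm_ell2_eq: "(norm a)\<^sup>2 = (\<Sum>j. (ell2_nth a j)\<^sup>2)"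
  unfolding power2_norm_eq_inner inner_ell2.rep_eq by (simp add: power2_eq_square)

text \<open>As a product of compact intervals the cube is compact for coordinatewise convergence.
  The square-summable bound \<open>c\<close> upgrades this convergence to norm convergence, so the
  cube is a continuous image of that product.\<close>

lemma compact_Hilbert_cube:
  assumes "summable (\<lambda>j. (c j)\<^sup>2)"
  shows "compact {a :: ell2. \<forall>j. \<bar>ell2_nth a j\<bar> \<le> c j}"
proof -
  define P where "P = {f :: nat \<Rightarrow> real. \<forall>j. \<bar>f j\<bar> \<le> c j}"
  have sq_le: "(f j)\<^sup>2 \<le> (c j)\<^sup>2" if "f \<in> P" for f j
  proof -
    have "\<bar>f j\<bar> \<le> c j" using that by (simp add: P_def)
    from power_mono[OF this, of 2] show ?thesis by simp
  qed
  have nth: "ell2_nth (Abs_ell2 f) = f" if "f \<in> P" for f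
  proof -
    have "summable (\<lambda>j. (f j)\<^sup>2)"
      using sq_le[OF that] by (intro summable_comparison_test'[OF assms]) simp
    then show ?thesis by (simp add: Abs_ell2_inverse)
  qed
  have "P = PiE UNIV (\<lambda>j. {- c j..c j})"
    by (auto simp: P_def PiE_def Pi_def abs_le_iff minus_le_iff)
  moreover have "compact (PiE UNIV (\<lambda>j. {- c j..c j}))"
    \<comment> \<open>Tychonoff's theorem; the topology of the function type is the product
      topology.\<close>
    using compactin_PiE[of "\<lambda>_::nat. euclideanreal" UNIV "\<lambda>j. {- c j..c j}"]
    by (simp add: euclidean_product_topology)
  ultimately have "compact P" by simp
  moreover have "continuous_on P Abs_ell2"
    \<comment> \<open>Sequences suffice since a countable product of real lines is
      metrizable.\<close>
    unfolding continuous_on_sequentially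
  proof (intro allI ballI impI, elim conjE)
    fix f g assume "g \<in> P" and f: "\<forall>n. f n \<in> P" and lim: "f \<longlonglongrightarrow> g"
    have "(\<lambda>n. \<Sum>j. (f n j - g j)\<^sup>2) \<longlonglongrightarrow> (\<Sum>j. (0::real))"
    \<comment> \<open>Dominated convergence for series: each term tends to 0, and |f n j - g j|
      \<le> 2 c j gives the summable majorant 4 (c j)^2.\<close>
    proof (rule tannerys_theorem[THEN conjunct2, THEN conjunct2])
      show "(\<lambda>n. (f n j - g j)\<^sup>2) \<longlonglongrightarrow> 0" for j
      proof -
        have "(\<lambda>n. f n j) \<longlonglongrightarrow> g j"
          using continuous_on_tendsto_compose[OF continuous_on_product_coordinates lim] by simp
        then have "(\<lambda>n. (f n j - g j)\<^sup>2) \<longlonglongrightarrow> (g j - g j)\<^sup>2"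
          by (intro tendsto_intros)
        then show ?thesis by simp
      qed
      have "norm ((f n j - g j)\<^sup>2) \<le> 4 * (c j)\<^sup>2" for j n
      proof -
        have "\<bar>f n j - g j\<bar> \<le> 2 * c j"
        proof -
          have "\<bar>f n j\<bar> \<le> c j" "\<bar>g j\<bar> \<le> c j"
            using f \<open>g \<in> P\<close> by (auto simp: P_def)
          then show ?thesis by linarith
        qed
        from power_mono[OF this, of 2] show ?thesis by (simp add: power_mult_distrib)
      qed
      then show "\<forall>\<^sub>F (j, n) in at_top \<times>\<^sub>F sequentially. norm ((f n j - g j)\<^sup>2) \<le> 4 * (c j)\<^sup>2"
        by (intro always_eventually) auto
      show "summable (\<lambda>j. 4 * (c j)\<^sup>2)"
        using assms by (rule summable_mult)
    qed simp
    moreover have "(norm (Abs_ell2 (f n) - Abs_ell2 g))\<^sup>2 = (\<Sum>j. (f n j - g j)\<^sup>2)" for n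
      using f \<open>g \<in> P\<close> by (simp add: norm_ell2_eq minus_ell2.rep_eq nth)
    ultimately have "(\<lambda>n. sqrt ((norm (Abs_ell2 (f n) - Abs_ell2 g))\<^sup>2)) \<longlonglongrightarrow> sqrt 0"
      by (intro tendsto_real_sqrt) simp
    then show "(Abs_ell2 \<circ> f) \<longlonglongrightarrow> Abs_ell2 g"
      by (subst tendsto_dist_iff) (simp add: dist_norm)
  qed
  ultimately have "compact (Abs_ell2 ` P)"
    by (rule compact_continuous_image[rotated])
  moreover have "Abs_ell2 ` P = {a. \<forall>j. \<bar>ell2_nth a j\<bar> \<le> c j}"
  proof (intro equalityI subsetI)
    fix a assume "a \<in> {a. \<forall>j. \<bar>ell2_nth a j\<bar> \<le> c j}"
    then have "ell2_nth a \<in> P" by (simp add: P_def)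
    then have "Abs_ell2 (ell2_nth a) \<in> Abs_ell2 ` P" by (rule imageI)
    then show "a \<in> Abs_ell2 ` P" by (simp add: ell2_nth_inverse)
  next
    fix a assume "a \<in> Abs_ell2 ` P"
    then show "a \<in> {a. \<forall>j. \<bar>ell2_nth a j\<bar> \<le> c j}"
      using nth by (auto simp: P_def)
  qed
  ultimately show ?thesis by simp
qed

context
  fixes T :: "'a::{real_inner, complete_space} \<Rightarrow> ell2" and k :: "nat \<Rightarrow> 'a"
  assumes nth_T: "\<And>x j. ell2_nth (T x) j = inner x (k j)"
    and summable_k: "summable (\<lambda>j. (norm (k j))\<^sup>2)"
begin

text \<open>Cauchy-Schwarz in each row, followed by summing the squares over all rows.\<close>

lemma bounded_linear_rows: "bounded_linear T"
proof (rule bounded_linear_intro)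
  show "T (x + y) = T x + T y" for x y
    by (simp add: ell2_nth_inject[symmetric] fun_eq_iff plus_ell2.rep_eq nth_T inner_add_left)
  show "T (r *\<^sub>R x) = r *\<^sub>R T x" for r x
    by (simp add: ell2_nth_inject[symmetric] fun_eq_iff scaleR_ell2.rep_eq nth_T)
  show "norm (T x) \<le> norm x * sqrt (\<Sum>j. (norm (k j))\<^sup>2)" for x
  proof (rule power2_le_imp_le)
    have "(norm (T x))\<^sup>2 \<le> (\<Sum>j. (norm x)\<^sup>2 * (norm (k j))\<^sup>2)"
      unfolding norm_ell2_eq
    proof (intro suminf_le summable_ell2_nth summable_mult summable_k)
      show "(ell2_nth (T x) j)\<^sup>2 \<le> (norm x)\<^sup>2 * (norm (k j))\<^sup>2" for j
        using power_mono[OF Cauchy_Schwarz_ineq2[of x "k j"], of 2]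
        by (simp add: nth_T power_mult_distrib)
    qed
    also have "\<dots> = (norm x * sqrt (\<Sum>j. (norm (k j))\<^sup>2))\<^sup>2"
      using summable_k by (simp add: suminf_mult power_mult_distrib suminf_nonneg)
    finally show "(norm (T x))\<^sup>2 \<le> (norm x * sqrt (\<Sum>j. (norm (k j))\<^sup>2))\<^sup>2" .
  qed (simp add: summable_k suminf_nonneg)
qed

lemma compact_operator_rows: "compact_operator T"
  unfolding compact_operator_def
proof (intro conjI allI impI bounded_linear_rows)
  fix B :: "'a set" assume "bounded B"
  then obtain M where M: "M > 0" "\<And>x. x \<in> B \<Longrightarrow> norm x \<le> M"
    by (auto simp: bounded_pos)
  define Q where "Q = {a. \<forall>j. \<bar>ell2_nth a j\<bar> \<le> M * norm (k j)}"
  have "compact Q"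
    unfolding Q_def using summable_mult[OF summable_k, of "M\<^sup>2"]
    by (intro compact_Hilbert_cube) (simp add: power_mult_distrib)
  moreover have "T ` B \<subseteq> Q"
  proof -
    have "\<bar>inner x (k j)\<bar> \<le> M * norm (k j)" if "x \<in> B" for x j
      using Cauchy_Schwarz_ineq2[of x "k j"] mult_right_mono[OF M(2)[OF that], of "norm (k j)"]
      by simp
    then show ?thesis by (auto simp: Q_def nth_T)
  qed
  ultimately have "closure (T ` B) \<subseteq> Q"
    by (simp add: closure_minimal compact_imp_closed)
  \<comment> \<open>A closed subset of the compact cube \<open>Q\<close> is compact.\<close>
  then show "compact (closure (T ` B))"
    using \<open>compact Q\<close> by (metis closed_closure compact_Int_closed inf.absorb2)
qed

lemma hilbert_schmidt_rows: "hilbert_schmidt T"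
proof -
  obtain E :: "'a set" where E: "orthonormal_basis E"
    using orthonormal_basis_exists by blast
  have "(\<lambda>e. (norm (T e))\<^sup>2) summable_on E"
  proof (rule nonneg_bounded_partial_sums_imp_summable_on)
    show "\<forall>\<^sub>F F in finite_subsets_at_top E. (\<Sum>e\<in>F. (norm (T e))\<^sup>2) \<le> (\<Sum>j. (norm (k j))\<^sup>2)"
    proof (rule eventually_finite_subsets_at_top_weakI)
      fix F assume F: "finite F" "F \<subseteq> E"
      \<comment> \<open>Entry \<open>j\<close> of \<open>T e\<close> is the Fourier coefficient of
        \<open>k j\<close> at \<open>e\<close>, so Bessel's inequality applies to
        \<open>k j\<close>. The bound is independent of \<open>F\<close>.\<close>
      have sum_k: "(\<Sum>e\<in>F. (ell2_nth (T e) j)\<^sup>2) \<le> (norm (k j))\<^sup>2" for j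
        using Bessel_inequality[of F "k j"] F E
        by (auto simp: orthonormal_basis_def nth_T inner_commute intro: pairwise_subset)
      \<comment> \<open>Exchanging the sums turns a sum over basis vectors into a sum over
        rows.\<close>
      have "(\<Sum>e\<in>F. (norm (T e))\<^sup>2) = (\<Sum>j. \<Sum>e\<in>F. (ell2_nth (T e) j)\<^sup>2)"
        unfolding norm_ell2_eq by (rule suminf_sum[symmetric]) (rule summable_ell2_nth)
      also have "\<dots> \<le> (\<Sum>j. (norm (k j))\<^sup>2)"
        by (intro suminf_le sum_k summable_k summable_sum summable_ell2_nth)
      finally show "(\<Sum>e\<in>F. (norm (T e))\<^sup>2) \<le> (\<Sum>j. (norm (k j))\<^sup>2)" .
    qed
  qed simp
  with E bounded_linear_rows show ?thesis
    by (auto simp: hilbert_schmidt_def)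
qed

end

section \<open>The rows of the composition\<close>

text \<open>For fixed \<open>s\<close> the indicator restricts t to (0, s); this is the inner
  integral after the order of integration is reversed.\<close>

lemma integral_power_lebesgue01:
  assumes s: "0 < s" "s < 1"
  shows "(LINT t|lebesgue01. indicat_real {t<..<1} s * t ^ j) = s ^ Suc j / (real j + 1)"
proof -
  have "(LINT t|lebesgue01. indicat_real {t<..<1} s * t ^ j)
      = (LINT t|lebesgue. indicat_real {0<..<1} t * (indicat_real {t<..<1} s * t ^ j))"
    by (simp add: integral_restrict_space)
  also have "\<dots> = (LINT t|lebesgue. indicat_real {0<..<s} t * t ^ j)"
    using s by (intro Bochner_Integration.integral_cong) (auto simp: indicator_def)
  also have "\<dots> = (LINT t|lborel. indicat_real {0<..<s} t * t ^ j)"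
    by (rule integral_completion) simp
  also have "\<dots> = (LINT t|lborel. t ^ j * indicat_real {0..s} t)"
  proof (rule integral_cong_AE)
    \<comment> \<open>The open and the closed interval differ only in the null set {0, s}.\<close>
    show "AE t in lborel. indicat_real {0<..<s} t * t ^ j = t ^ j * indicat_real {0..s} t"
      using AE_lborel_singleton[of 0] AE_lborel_singleton[of s]
      by eventually_elim (auto simp: indicator_def)
  qed simp_all
  also have "\<dots> = s ^ Suc j / (real j + 1)"
    using s by (subst integral_power) (auto simp: add.commute)
  finally show ?thesis .
qed

lemma square_integrable_kernel: "square_integrable lebesgue01 (\<lambda>s. s ^ j / (real j + 1))"
proof -
  interpret finite_measure lebesgue01
    by (rule finite_measure_lebesgue01)
  have "integrable lebesgue01 (\<lambda>s. (s ^ j / (real j + 1))\<^sup>2)"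
  proof (rule integrable_const_bound[of _ 1])
    show "AE s in lebesgue01. norm ((s ^ j / (real j + 1))\<^sup>2) \<le> 1"
      using AE_lebesgue01
      by eventually_elim (auto simp: abs_square_le_1 divide_le_eq intro: order_trans[OF power_le_one])
  qed measurable
  then show ?thesis by (simp add: square_integrable_def)
qed

lemma integral_power_cesaro:
  assumes x: "square_integrable lebesgue01 x"
  shows "(LINT t|lebesgue01. (LINT s|lebesgue_on {t<..<1}. x s / s) * t ^ j)
    = (LINT s|lebesgue01. x s * (s ^ j / (real j + 1)))"
proof -
  interpret finite_measure lebesgue01
    by (rule finite_measure_lebesgue01)
  interpret P: pair_sigma_finite lebesgue01 lebesgue01
    by unfold_locales
  \<comment> \<open>The variable \<open>s\<close> comes first, so that Fubini's hypotheses are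
    checked with the integral over t inside, where it is explicit.\<close>
  define f where "f s t = indicat_real {t<..<1} s * (x s / s) * t ^ j" for s t
  have [measurable]: "x \<in> borel_measurable lebesgue01"
    using x by (rule square_integrable_measurable)
  have fst_m [measurable]: "(\<lambda>p. fst p) \<in> borel_measurable (lebesgue01 \<Otimes>\<^sub>M lebesgue01)"
    by (rule measurable_compose[OF measurable_fst measurable_ident_lebesgue01])
  have snd_m [measurable]: "(\<lambda>p. snd p) \<in> borel_measurable (lebesgue01 \<Otimes>\<^sub>M lebesgue01)"
    by (rule measurable_compose[OF measurable_snd measurable_ident_lebesgue01])
  have [measurable]: "(\<lambda>p. x (fst p)) \<in> borel_measurable (lebesgue01 \<Otimes>\<^sub>M lebesgue01)"
    by (rule measurable_compose[OF measurable_fst]) measurable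
  have [measurable]: "Measurable.pred (lebesgue01 \<Otimes>\<^sub>M lebesgue01) (\<lambda>p. fst p \<in> {snd p<..<1})"
    unfolding greaterThanLessThan_iff
    using fst_m snd_m by (intro pred_intros_logic borel_measurable_less borel_measurable_const) auto
  have f_meas: "(\<lambda>p. f (fst p) (snd p)) \<in> borel_measurable (lebesgue01 \<Otimes>\<^sub>M lebesgue01)"
    unfolding f_def by measurable
  \<comment> \<open>The free factor \<open>r\<close> serves twice: as |x s / s| for absolute
    integrability and as x s / s for the value.\<close>
  have inner_integral: "(LINT t|lebesgue01. indicat_real {t<..<1} s * r * t ^ j) = r * s ^ Suc j / (real j + 1)"
    if "0 < s" "s < 1" for s r
  proof -
    have "(LINT t|lebesgue01. indicat_real {t<..<1} s * r * t ^ j)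
        = (LINT t|lebesgue01. r * (indicat_real {t<..<1} s * t ^ j))"
      by (intro Bochner_Integration.integral_cong) auto
    then show ?thesis
      using integral_power_lebesgue01[OF that] by simp
  qed
  have "integrable (lebesgue01 \<Otimes>\<^sub>M lebesgue01) (\<lambda>p. f (fst p) (snd p))"
  proof (rule P.Fubini_integrable[OF f_meas])
    have "integrable lebesgue01 (\<lambda>s. \<bar>x s * (s ^ j / (real j + 1))\<bar>)"
      using square_integrable_mult[OF x square_integrable_kernel] by (rule integrable_abs)
    \<comment> \<open>Integrating |f| over t gives |x s| s^j/(j+1), whose integrability was just
      obtained from two square-integrable factors.\<close>
    also have "?this \<longleftrightarrow> integrable lebesgue01 (\<lambda>s. LINT t|lebesgue01. norm (f (fst (s, t)) (snd (s, t))))"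
    proof (rule Bochner_Integration.integrable_cong[OF refl])
      fix s assume "s \<in> space lebesgue01"
      then have s: "0 < s" "s < 1" by auto
      have "(LINT t|lebesgue01. norm (f (fst (s, t)) (snd (s, t))))
          = (LINT t|lebesgue01. indicat_real {t<..<1} s * \<bar>x s / s\<bar> * t ^ j)"
        by (intro Bochner_Integration.integral_cong) (auto simp: f_def abs_mult)
      also have "\<dots> = \<bar>x s / s\<bar> * s ^ Suc j / (real j + 1)"
        using s by (rule inner_integral)
      also have "\<dots> = \<bar>x s * (s ^ j / (real j + 1))\<bar>"
        using s by (simp add: abs_mult)
      finally show "\<bar>x s * (s ^ j / (real j + 1))\<bar> = (LINT t|lebesgue01. norm (f (fst (s, t)) (snd (s, t))))"
        by simp
    qed
    finally show "integrable lebesgue01 (\<lambda>s. LINT t|lebesgue01. norm (f (fst (s, t)) (snd (s, t))))" .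
    have "integrable lebesgue01 (\<lambda>t. f s t)" if "s \<in> space lebesgue01" for s
    \<comment> \<open>For fixed \<open>s\<close> the integrand is bounded by a constant on a space
      of finite measure.\<close>
    proof (rule integrable_const_bound[of _ "\<bar>x s / s\<bar>"])
      show "AE t in lebesgue01. norm (f s t) \<le> \<bar>x s / s\<bar>"
        using AE_lebesgue01
      proof eventually_elim
        case (elim t)
        then have "\<bar>indicat_real {t<..<1} s * t ^ j\<bar> \<le> 1"
          by (auto simp: indicator_def power_le_one)
        then have "\<bar>x s / s\<bar> * \<bar>indicat_real {t<..<1} s * t ^ j\<bar> \<le> \<bar>x s / s\<bar> * 1"
          by (intro mult_left_mono) auto
        then show ?case by (simp add: f_def abs_mult mult_ac)
      qed
      show "(\<lambda>t. f s t) \<in> borel_measurable lebesgue01"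
        using measurable_Pair2[OF f_meas that] by simp
    qed
    then show "AE s in lebesgue01. integrable lebesgue01 (\<lambda>t. f (fst (s, t)) (snd (s, t)))"
      by (intro AE_I2) simp
  qed
  then have fubini: "(LINT t|lebesgue01. LINT s|lebesgue01. f s t) = (LINT s|lebesgue01. LINT t|lebesgue01. f s t)"
    by (intro P.Fubini_integral) (simp add: split_beta')
  have "(LINT t|lebesgue01. (LINT s|lebesgue_on {t<..<1}. x s / s) * t ^ j)
      = (LINT t|lebesgue01. LINT s|lebesgue01. f s t)"
  proof (rule Bochner_Integration.integral_cong[OF refl])
    fix t assume "t \<in> space lebesgue01"
    then have "0 < t" by auto
    then show "(LINT s|lebesgue_on {t<..<1}. x s / s) * t ^ j = (LINT s|lebesgue01. f s t)"
      unfolding f_def by (simp only: integral_cesaro_eq integral_mult_left_zero)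
  qed
  also have "\<dots> = (LINT s|lebesgue01. x s * (s ^ j / (real j + 1)))"
    unfolding fubini
  proof (rule Bochner_Integration.integral_cong[OF refl])
    fix s assume "s \<in> space lebesgue01"
    then have s: "0 < s" "s < 1" by auto
    show "(LINT t|lebesgue01. f s t) = x s * (s ^ j / (real j + 1))"
      unfolding f_def inner_integral[OF s] using s by simp
  qed
  finally show ?thesis .
qed

text \<open>This is the Cesaro operator C applied to the monomial t^j, as (1/s) times the integral
  of t^j over (0, s) is s^j/(j+1).\<close>

lift_definition moment_kernel :: "nat \<Rightarrow> L2" is "\<lambda>j s. s ^ j / (real j + 1)"
  by (simp add: L2_rel_def square_integrable_kernel)

lemma nth_hausdorff_cesaro_adj:
  "ell2_nth (hausdorff (cesaro_adj x)) j = inner x (moment_kernel j)"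
  by transfer (simp add: L2_rel_def integral_power_cesaro)

text \<open>Bounding s^(2j) by 1 on an interval of length 1 is enough for a summable
  majorant.\<close>

lemma norm_moment_kernel_le: "(norm (moment_kernel j))\<^sup>2 \<le> 1 / (real j + 1)\<^sup>2"
  unfolding power2_norm_eq_inner
proof transfer
  fix j
  interpret finite_measure lebesgue01
    by (rule finite_measure_lebesgue01)
  have "(LINT s|lebesgue01. s ^ j / (real j + 1) * (s ^ j / (real j + 1)))
      \<le> (LINT s|lebesgue01. 1 / (real j + 1)\<^sup>2)"
  proof (rule integral_mono)
    fix s :: real assume "s \<in> space lebesgue01"
    then have "s ^ j * s ^ j \<le> 1"
      by (auto intro!: mult_le_one power_le_one)
    then show "s ^ j / (real j + 1) * (s ^ j / (real j + 1)) \<le> 1 / (real j + 1)\<^sup>2"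
      by (simp add: power2_eq_square divide_right_mono)
  qed (use square_integrable_mult[OF square_integrable_kernel square_integrable_kernel] in auto)
  then show "(LINT s|lebesgue01. s ^ j / (real j + 1) * (s ^ j / (real j + 1))) \<le> 1 / (real j + 1)\<^sup>2"
    by (simp add: measure_restrict_space)
qed

lemma summable_moment_kernel: "summable (\<lambda>j. (norm (moment_kernel j))\<^sup>2)"
proof (rule summable_comparison_test')
  \<comment> \<open>The Basel series, indexed from 0.\<close>
  show "summable (\<lambda>j. 1 / (real j + 1)\<^sup>2)"
    using inverse_squares_sums by (simp add: sums_iff add.commute)
  show "norm ((norm (moment_kernel j))\<^sup>2) \<le> 1 / (real j + 1)\<^sup>2" for j
    using norm_moment_kernel_le by simp
qed

theorem proposition2:
  fixes T :: "L2 \<Rightarrow> ell2"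
  defines "T \<equiv> hausdorff \<circ> cesaro_adj"
  shows "compact_operator T \<and> hilbert_schmidt T"
proof -
  have "ell2_nth (T x) j = inner x (moment_kernel j)" for x j
    by (simp add: T_def nth_hausdorff_cesaro_adj)
  then show ?thesis
    using compact_operator_rows hilbert_schmidt_rows summable_moment_kernel by blast
qed

end
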